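(* Let $A$ be a type, $Q : A\to\mathbb{B}$ and $t:\mathsf{cotree}\,A$. Then $\mathsf{wp}\,[Q]\,t = \mu(\mathsf{preimage}\,Q\,t)$.
   Context: $\mathsf{cotree}\,A$ is the coinductive type with constructors $\bot$, $\mathsf{coleaf}\,a$, $\mathsf{conode}\,k$ ($k:\mathbb{B}\to\mathsf{cotree}\,A$), ordered coinductively by $\bot\sqsubseteq t$, $\mathsf{coleaf}\,a\sqsubseteq\mathsf{coleaf}\,a$, and $\mathsf{conode}\,f\sqsubseteq\mathsf{conode}\,g$ when $f\,b\sqsubseteq g\,b$ for all $b$; order-equivalent cotrees are assumed equal (axiom). $\mathsf{tree}\,A$ is the inductive analogue (constructors $\bot,\mathsf{leaf},\mathsf{node}$) with the analogous order; $\mathsf{idl}\,t\,i$ is the depth-$i$ truncation of $t$ (depth $0$ gives $\bot$). For monotone $h:\mathsf{tree}\,A\to C$ into an ordered type $C$ where directed sequences have suprema, $\overline h(t):=\sup_i h(\mathsf{idl}\,t\,i)$ (chosen supremum). $\mathsf{fold}\,z\,f\,g$ on $\mathsf{tree}\,A$: $\bot\mapsto z$, $\mathsf{leaf}\,a\mapsto f\,a$, $\mathsf{node}\,k\mapsto g(\mathsf{fold}\,z\,f\,g\circ k)$. $\mathsf{wp}\,f:=\overline{\mathsf{fold}\,0\,f\,(\lambda k.(k\,\mathbf{true}+k\,\mathbf{false})/2)}:\mathsf{cotree}\,A\to\mathbb{R}^\infty_{\ge0}$; $[Q]a=1$ if $Q\,a=\mathbf{true}$, else $0$. $\mathsf{map}\,h$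 on cotrees replaces each $\mathsf{coleaf}\,x$ by $\mathsf{coleaf}(h\,x)$ (corecursively). $\mathsf{lang} := \overline{\mathsf{fold}\,\bot\,(\lambda\_.\,\mathsf{coleaf}\,\mathsf{nil})\,(\lambda g.\,\mathsf{conode}(\lambda b.\,\mathsf{map}\,(\mathsf{cons}\,b)\,(g\,b)))} : \mathsf{cotree}\,A\to\mathsf{cotree}(\mathsf{list}\,\mathbb{B})$. $\mathsf{filter}\,Q:=\overline{\mathsf{fold}\,\bot\,(\lambda a.\,\text{if }Q\,a\text{ then }\mathsf{coleaf}\,a\text{ else }\bot)\,\mathsf{conode}}:\mathsf{cotree}\,A\to\mathsf{cotree}\,A$. $\mathsf{preimage}\,Q := \mathsf{lang}\circ\mathsf{filter}\,Q$. $\mu:=\overline{\mathsf{fold}\,0\,(\lambda l.\,2^{-\mathrm{length}\,l})\,(\lambda g.\,g\,\mathbf{true}+g\,\mathbf{false})}:\mathsf{cotree}(\mathsf{list}\,\mathbb{B})\to\mathbb{R}^\infty_{\ge0}$. *)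

theory Defs
  imports "HOL-Library.Extended_Nonnegative_Real"
begin

section \<open>Ordered types with suprema of directed sequences\<close>

definition (in order) directed_seq :: "(nat \<Rightarrow> 'a) \<Rightarrow> bool" where
  "directed_seq f \<longleftrightarrow> (\<forall>i j. \<exists>k. f i \<le> f k \<and> f j \<le> f k)"

definition (in order) is_supremum :: "'a \<Rightarrow> (nat \<Rightarrow> 'a) \<Rightarrow> bool" where
  "is_supremum s f \<longleftrightarrow> (\<forall>i. f i \<le> s) \<and> (\<forall>u. (\<forall>i. f i \<le> u) \<longrightarrow> s \<le> u)"

class directed_complete = order +
  assumes directed_has_supremum:
    "directed_seq f \<Longrightarrow> \<exists>s. is_supremum s f"

definition seq_sup :: "(nat \<Rightarrow> 'a::directed_complete) \<Rightarrow> 'a" where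
  "seq_sup f = (SOME s. is_supremum s f)"

lemma is_supremum_unique: "is_supremum s f \<Longrightarrow> is_supremum s' f \<Longrightarrow> s = s'"
  unfolding is_supremum_def by (meson order.antisym)

lemma seq_sup_eqI: "is_supremum s f \<Longrightarrow> seq_sup f = s"
  unfolding seq_sup_def by (rule some_equality) (auto intro: is_supremum_unique)

lemma is_supremum_seq_sup: "directed_seq f \<Longrightarrow> is_supremum (seq_sup f) f"
  unfolding seq_sup_def by (rule someI_ex) (rule directed_has_supremum)

lemma directed_seq_mono: "mono f \<Longrightarrow> directed_seq f"
  unfolding directed_seq_def by (meson max.cobounded1 max.cobounded2 monoD)

lemma is_supremum_SUP: "is_supremum (SUP i. f i) f" for f :: "nat \<Rightarrow> 'a::complete_lattice"
  by (auto simp: is_supremum_def intro: SUP_upper SUP_least)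

instance ennreal :: directed_complete
  by standard (blast intro: is_supremum_SUP)


section \<open>Trees\<close>

datatype 'a tree = Bot | Leaf 'a | Node "bool \<Rightarrow> 'a tree"

instantiation tree :: (type) order
begin

inductive less_eq_tree :: "'a tree \<Rightarrow> 'a tree \<Rightarrow> bool" where
  Bot: "less_eq_tree Bot t"
| Leaf: "less_eq_tree (Leaf a) (Leaf a)"
| Node: "(\<And>b. less_eq_tree (f b) (g b)) \<Longrightarrow> less_eq_tree (Node f) (Node g)"

definition less_tree :: "'a tree \<Rightarrow> 'a tree \<Rightarrow> bool" where
  "less_tree s t \<longleftrightarrow> s \<le> t \<and> \<not> t \<le> s"

instance
proof
  fix x y z :: "'a tree"
  show "x < y \<longleftrightarrow> x \<le> y \<and> \<not> y \<le> x"
    by (rule less_tree_def)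
  show "x \<le> x"
    by (induction x) (auto intro: less_eq_tree.intros)
  show "x \<le> y \<Longrightarrow> y \<le> z \<Longrightarrow> x \<le> z"
  proof (induction x y arbitrary: z rule: less_eq_tree.induct)
    case (Node f g)
    from Node.prems Node.IH show ?case
      by (cases rule: less_eq_tree.cases) (auto intro: less_eq_tree.intros)
  qed (auto intro: less_eq_tree.intros)
  show "x \<le> y \<Longrightarrow> y \<le> x \<Longrightarrow> x = y"
  proof (induction x y rule: less_eq_tree.induct)
    case (Bot t)
    then show ?case by (cases rule: less_eq_tree.cases) auto
  next
    case (Node f g)
    from Node.prems Node.IH show ?case
      by (cases rule: less_eq_tree.cases) auto
  qed auto
qed

end

primrec fold_tree :: "'c \<Rightarrow> ('a \<Rightarrow> 'c) \<Rightarrow> ((bool \<Rightarrow> 'c) \<Rightarrow> 'c) \<Rightarrow> 'a tree \<Rightarrow> 'c" where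
  "fold_tree z f g Bot = z"
| "fold_tree z f g (Leaf a) = f a"
| "fold_tree z f g (Node k) = g (fold_tree z f g \<circ> k)"

lemma mono_fold_tree:
  fixes z :: "'c::order"
  assumes bot: "\<And>x. z \<le> x" and g: "mono g"
  shows "mono (fold_tree z f g)"
proof
  fix s t :: "'a tree"
  assume "s \<le> t"
  then show "fold_tree z f g s \<le> fold_tree z f g t"
    by (induction s t rule: less_eq_tree.induct)
       (auto simp: bot intro!: monoD[OF g] le_funI)
qed


section \<open>Cotrees\<close>

codatatype 'a cotree = CoBot | CoLeaf 'a | CoNode (children: "bool \<Rightarrow> 'a cotree")
  for map: map_cotree
  where "children CoBot = (\<lambda>_. CoBot)"
      | "children (CoLeaf a) = (\<lambda>_. CoBot)"

instantiation cotree :: (type) order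
begin

coinductive less_eq_cotree :: "'a cotree \<Rightarrow> 'a cotree \<Rightarrow> bool" where
  CoBot: "less_eq_cotree CoBot t"
| CoLeaf: "less_eq_cotree (CoLeaf a) (CoLeaf a)"
| CoNode: "(\<And>b. less_eq_cotree (f b) (g b)) \<Longrightarrow> less_eq_cotree (CoNode f) (CoNode g)"

definition less_cotree :: "'a cotree \<Rightarrow> 'a cotree \<Rightarrow> bool" where
  "less_cotree s t \<longleftrightarrow> s \<le> t \<and> \<not> t \<le> s"

instance
proof
  fix x y z :: "'a cotree"
  show "x < y \<longleftrightarrow> x \<le> y \<and> \<not> y \<le> x"
    by (rule less_cotree_def)
  show "x \<le> x"
  proof (coinduction arbitrary: x rule: less_eq_cotree.coinduct)
    case less_eq_cotree
    then show ?case by (cases x) auto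
  qed
  show "x \<le> y \<Longrightarrow> y \<le> z \<Longrightarrow> x \<le> z"
  proof (coinduction arbitrary: x y z rule: less_eq_cotree.coinduct)
    case less_eq_cotree
    from less_eq_cotree(1) show ?case
    proof (cases rule: less_eq_cotree.cases)
      case (CoNode f g)
      from less_eq_cotree(2) CoNode show ?thesis
        by (cases rule: less_eq_cotree.cases) auto
    qed (use less_eq_cotree(2) in \<open>auto elim: less_eq_cotree.cases\<close>)
  qed
  show "x \<le> y \<Longrightarrow> y \<le> x \<Longrightarrow> x = y"
  proof (coinduction arbitrary: x y rule: cotree.coinduct_strong)
    case Eq_cotree
    from Eq_cotree(1) show ?case
    proof (cases rule: less_eq_cotree.cases)
      case (CoNode f g)
      from Eq_cotree(2) CoNode show ?thesis
        by (cases rule: less_eq_cotree.cases) (auto simp: rel_fun_def)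
    qed (use Eq_cotree(2) in \<open>auto elim: less_eq_cotree.cases\<close>)
  qed
qed

end

inductive_simps less_eq_cotree_simps [simp]:
  "CoBot \<le> t"
  "CoLeaf a \<le> t"
  "CoNode f \<le> t"
  "t \<le> CoBot"

lemma children_mono: "s \<le> t \<Longrightarrow> children s b \<le> children t b"
  by (erule less_eq_cotree.cases) auto

primcorec cotree_sup :: "(nat \<Rightarrow> 'a cotree) \<Rightarrow> 'a cotree" where
  "cotree_sup f =
    (if \<exists>i a. f i = CoLeaf a then CoLeaf (SOME a. \<exists>i. f i = CoLeaf a)
     else if \<exists>i k. f i = CoNode k then CoNode (\<lambda>b. cotree_sup (\<lambda>i. children (f i) b))
     else CoBot)"

lemma directed_seq_children: "directed_seq f \<Longrightarrow> directed_seq (\<lambda>i. children (f i) b)"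
  unfolding directed_seq_def by (meson children_mono)

lemma directed_seq_CoLeaf:
  assumes "directed_seq f" and "f i = CoLeaf a"
  shows "f j = CoBot \<or> f j = CoLeaf a"
proof -
  obtain k where k: "f i \<le> f k" "f j \<le> f k"
    using assms(1) unfolding directed_seq_def by blast
  then have "f k = CoLeaf a" using assms(2) by auto
  with k(2) show ?thesis by (cases "f j") auto
qed

lemma cotree_sup_CoLeaf:
  assumes "directed_seq f" and "f i = CoLeaf a"
  shows "cotree_sup f = CoLeaf a"
proof -
  have "(SOME a. \<exists>i. f i = CoLeaf a) = a"
    by (rule some_equality) (use assms directed_seq_CoLeaf[OF assms] in \<open>auto, metis cotree.distinct(1) cotree.inject(1)\<close>)
  then show ?thesis
    using assms(2) by (subst cotree_sup.code) auto
qed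

lemma cotree_sup_CoNode:
  assumes "directed_seq f" and "f i = CoNode k"
  shows "cotree_sup f = CoNode (\<lambda>b. cotree_sup (\<lambda>i. children (f i) b))"
proof -
  have "\<not> (\<exists>i a. f i = CoLeaf a)"
    using directed_seq_CoLeaf[OF assms(1)] assms(2) by (metis cotree.distinct(3,5))
  then show ?thesis
    using assms(2) by (subst cotree_sup.code) auto
qed

lemma cotree_sup_upper: "directed_seq f \<Longrightarrow> f i \<le> cotree_sup f"
proof (coinduction arbitrary: f rule: less_eq_cotree.coinduct)
  case less_eq_cotree
  show ?case
  proof (cases "f i")
    case (CoNode k)
    have "children (f i) b = k b" for b using CoNode by simp
    then show ?thesis
      using CoNode cotree_sup_CoNode[OF less_eq_cotree CoNode]
        directed_seq_children[OF less_eq_cotree] by (auto, metis)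
  qed (use cotree_sup_CoLeaf[OF less_eq_cotree] in auto)
qed

lemma cotree_sup_least: "directed_seq f \<Longrightarrow> \<forall>i. f i \<le> u \<Longrightarrow> cotree_sup f \<le> u"
proof (coinduction arbitrary: f u rule: less_eq_cotree.coinduct)
  case less_eq_cotree
  consider (leaf) i a where "f i = CoLeaf a" | (node) i k where "f i = CoNode k"
    | (bot) "\<And>i. f i = CoBot"
    by (metis cotree.exhaust)
  then show ?case
  proof cases
    case leaf
    then show ?thesis
      using cotree_sup_CoLeaf[OF less_eq_cotree(1) leaf] less_eq_cotree(2)[rule_format, of i] by simp
  next
    case node
    obtain g where g: "u = CoNode g"
      using less_eq_cotree(2)[rule_format, of i] node by auto
    have "children (f j) b \<le> g b" for j b
      using children_mono[OF less_eq_cotree(2)[rule_format, of j], of b] g by simp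
    then show ?thesis
      using cotree_sup_CoNode[OF less_eq_cotree(1) node] g
        directed_seq_children[OF less_eq_cotree(1)] by auto
  next
    case bot
    then have "cotree_sup f = CoBot" by (subst cotree_sup.code) auto
    then show ?thesis by simp
  qed
qed

instance cotree :: (type) directed_complete
  by standard (auto simp: is_supremum_def intro!: exI cotree_sup_upper cotree_sup_least)

lemma map_cotree_mono: "s \<le> t \<Longrightarrow> map_cotree h s \<le> map_cotree h t"
proof (coinduction arbitrary: s t rule: less_eq_cotree.coinduct)
  case less_eq_cotree
  then show ?case by (cases rule: less_eq_cotree.cases) auto
qed


section \<open>Continuous extensions\<close>

primrec idl :: "'a cotree \<Rightarrow> nat \<Rightarrow> 'a tree" where
  "idl t 0 = Bot"
| "idl t (Suc i) =
    (case t of CoBot \<Rightarrow> Bot | CoLeaf a \<Rightarrow> Leaf a | CoNode k \<Rightarrow> Node (\<lambda>b. idl (k b) i))"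

lemma mono_idl: "mono (idl t)"
proof (rule mono_iff_le_Suc[THEN iffD2], rule allI)
  fix i
  show "idl t i \<le> idl t (Suc i)"
    by (induction i arbitrary: t)
       (auto split: cotree.splits intro: less_eq_tree.intros)
qed

text \<open>The extension is only meaningful for monotone functions. The functions it is applied to
  below are shown to be monotone, so the sequences whose supremum is taken are directed.\<close>

definition co :: "('a tree \<Rightarrow> 'c::directed_complete) \<Rightarrow> 'a cotree \<Rightarrow> 'c" where
  "co h t = seq_sup (\<lambda>i. h (idl t i))"

lemma is_supremum_co: "mono h \<Longrightarrow> is_supremum (co h t) (\<lambda>i. h (idl t i))"
  unfolding co_def
  by (intro is_supremum_seq_sup directed_seq_mono) (auto simp: mono_def intro: monoD[OF mono_idl])

definition wp :: "('a \<Rightarrow> ennreal) \<Rightarrow> 'a cotree \<Rightarrow> ennreal" where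
  "wp f = co (fold_tree 0 f (\<lambda>k. (k True + k False) / 2))"

definition iverson :: "('a \<Rightarrow> bool) \<Rightarrow> 'a \<Rightarrow> ennreal" where
  "iverson Q a = (if Q a then 1 else 0)"

definition lang :: "'a cotree \<Rightarrow> bool list cotree" where
  "lang = co (fold_tree CoBot (\<lambda>_. CoLeaf []) (\<lambda>g. CoNode (\<lambda>b. map_cotree ((#) b) (g b))))"

definition cotree_filter :: "('a \<Rightarrow> bool) \<Rightarrow> 'a cotree \<Rightarrow> 'a cotree" where
  "cotree_filter Q = co (fold_tree CoBot (\<lambda>a. if Q a then CoLeaf a else CoBot) CoNode)"

definition preimage :: "('a \<Rightarrow> bool) \<Rightarrow> 'a cotree \<Rightarrow> bool list cotree" where
  "preimage Q = lang \<circ> cotree_filter Q"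

definition mu :: "bool list cotree \<Rightarrow> ennreal" where
  "mu = co (fold_tree 0 (\<lambda>l. 1 / 2 ^ length l) (\<lambda>g. g True + g False))"

lemma mono_wp_fold: "mono (fold_tree 0 f (\<lambda>k. (k True + k False) / 2 :: ennreal))"
  by (rule mono_fold_tree) (auto simp: mono_def le_fun_def intro!: divide_right_mono_ennreal add_mono)

lemma mono_lang_fold:
  "mono (fold_tree CoBot (\<lambda>_. CoLeaf []) (\<lambda>g. CoNode (\<lambda>b. map_cotree ((#) b) (g b))))"
  by (rule mono_fold_tree) (auto simp: mono_def le_fun_def intro: map_cotree_mono)

lemma mono_filter_fold:
  "mono (fold_tree CoBot (\<lambda>a. if Q a then CoLeaf a else CoBot) CoNode)"
  by (rule mono_fold_tree) (auto simp: mono_def le_fun_def)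

lemma mono_mu_fold: "mono (fold_tree 0 f (\<lambda>g. g True + g False :: ennreal))"
  by (rule mono_fold_tree) (auto simp: mono_def le_fun_def intro: add_mono)

end

theory Submission
  imports Defs
begin

text \<open>Both \<open>lang\<close> and \<open>cotree_filter Q\<close> are continuous, so they satisfy on cotrees the defining
  equations of the folds they extend. Hence they preserve depth, and the two sides agree already on
  every truncation of depth \<open>i\<close>: a branch \<open>b\<close> of \<open>lang\<close> prefixes every word below it with \<open>b\<close>, which
  halves its weight \<open>1 / 2 ^ length l\<close>, exactly as the averaging in \<open>wp\<close> does.\<close>

text \<open>Only the term at index 0 is dropped, and it lies below the next one, so both sequences
  have the same upper bounds.\<close>

lemma is_supremum_Suc_iff:
  assumes "mono f"
  shows "is_supremum s (\<lambda>i. f (Suc i)) \<longleftrightarrow> is_supremum s f"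
proof -
  have "f i \<le> f (Suc i)" for i
    by (rule monoD[OF assms]) simp
  then have "(\<forall>i. f (Suc i) \<le> u) \<longleftrightarrow> (\<forall>i. f i \<le> u)" for u
    by (meson order.trans)
  then show ?thesis
    unfolding is_supremum_def by simp
qed

lemma mono_comp_idl: "mono h \<Longrightarrow> mono (\<lambda>i. h (idl t i))"
  by (simp add: mono_def monoD[OF mono_idl])

text \<open>\<open>idl t 0\<close> is \<open>Bot\<close> whatever \<open>t\<close> is; from depth
  \<open>Suc i\<close> on, truncation exposes the constructor of \<open>t\<close>, so the equations
  for \<open>co h\<close> are read off there.\<close>

lemma co_eqI_Suc: "mono h \<Longrightarrow> is_supremum s (\<lambda>i. h (idl t (Suc i))) \<Longrightarrow> co h t = s"
  unfolding co_def by (intro seq_sup_eqI) (simp only: is_supremum_Suc_iff[OF mono_comp_idl])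

lemma co_CoBot: "mono h \<Longrightarrow> co h CoBot = h Bot"
  by (rule co_eqI_Suc) (auto simp: is_supremum_def)

lemma co_CoLeaf: "mono h \<Longrightarrow> co h (CoLeaf a) = h (Leaf a)"
  by (rule co_eqI_Suc) (auto simp: is_supremum_def)

text \<open>Nodes are ordered branchwise and anything above a node is a node, so suprema are formed
  in each branch separately.\<close>

lemma is_supremum_CoNode:
  assumes "\<And>b. is_supremum (s b) (f b)"
  shows "is_supremum (CoNode s) (\<lambda>i. CoNode (\<lambda>b. f b i))"
  unfolding is_supremum_def
proof (intro conjI allI impI)
  show "CoNode (\<lambda>b. f b i) \<le> CoNode s" for i
    using assms by (simp add: is_supremum_def)
  show "CoNode s \<le> u" if "\<forall>i. CoNode (\<lambda>b. f b i) \<le> u" for u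
    using that assms by (cases u) (auto simp: is_supremum_def)
qed

text \<open>The half of the continuity of \<open>map_cotree\<close> that monotonicity does not give.
  It is phrased with \<open>cotree_sup\<close>, whose corecursive equations drive the
  coinduction.\<close>

lemma map_cotree_sup_least:
  "directed_seq f \<Longrightarrow> \<forall>i. map_cotree h (f i) \<le> u \<Longrightarrow> map_cotree h (cotree_sup f) \<le> u"
proof (coinduction arbitrary: f u rule: less_eq_cotree.coinduct)
  case less_eq_cotree
  consider (leaf) i a where "f i = CoLeaf a" | (node) i k where "f i = CoNode k"
    | (bot) "\<And>i. f i = CoBot"
    by (metis cotree.exhaust)
  then show ?case
  proof cases
    case leaf
    then show ?thesis
      using cotree_sup_CoLeaf[OF less_eq_cotree(1) leaf] less_eq_cotree(2)[rule_format, of i] by simp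
  next
    case node
    obtain g where g: "u = CoNode g"
      using less_eq_cotree(2)[rule_format, of i] node by auto
    \<comment> \<open>If \<open>f j\<close> is \<open>CoBot\<close>, its \<open>children\<close>
      default to \<open>CoBot\<close> and the bound is trivial.\<close>
    have "map_cotree h (children (f j) b) \<le> g b" for j b
      using less_eq_cotree(2)[rule_format, of j] g by (cases "f j") auto
    then show ?thesis
      using cotree_sup_CoNode[OF less_eq_cotree(1) node] g
        directed_seq_children[OF less_eq_cotree(1)] by fastforce
  next
    case bot
    then have "cotree_sup f = CoBot" by (subst cotree_sup.code) auto
    then show ?thesis by simp
  qed
qed

lemma is_supremum_map_cotree:
  assumes "directed_seq f" and "is_supremum s f"
  shows "is_supremum (map_cotree h s) (\<lambda>i. map_cotree h (f i))"
proof -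
  have "is_supremum (cotree_sup f) f"
    using assms(1) by (auto simp: is_supremum_def intro: cotree_sup_upper cotree_sup_least)
  then have "s = cotree_sup f"
    using assms(2) by (rule is_supremum_unique[symmetric])
  then show ?thesis
    using assms by (auto simp: is_supremum_def intro: map_cotree_mono map_cotree_sup_least)
qed

lemma cotree_filter_simps [simp]:
  "cotree_filter Q CoBot = CoBot"
  "cotree_filter Q (CoLeaf a) = (if Q a then CoLeaf a else CoBot)"
  "cotree_filter Q (CoNode k) = CoNode (\<lambda>b. cotree_filter Q (k b))"
proof -
  show "cotree_filter Q (CoNode k) = CoNode (\<lambda>b. cotree_filter Q (k b))"
    unfolding cotree_filter_def
  proof (rule co_eqI_Suc[OF mono_filter_fold], simp add: comp_def)
    show "is_supremum
      (CoNode (\<lambda>b. co (fold_tree CoBot (\<lambda>a. if Q a then CoLeaf a else CoBot) CoNode) (k b)))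
      (\<lambda>i. CoNode (\<lambda>b. fold_tree CoBot (\<lambda>a. if Q a then CoLeaf a else CoBot) CoNode (idl (k b) i)))"
      by (intro is_supremum_CoNode is_supremum_co mono_filter_fold)
  qed
qed (simp_all add: cotree_filter_def co_CoBot co_CoLeaf mono_filter_fold)

lemma lang_simps [simp]:
  "lang CoBot = CoBot"
  "lang (CoLeaf a) = CoLeaf []"
  "lang (CoNode k) = CoNode (\<lambda>b. map_cotree ((#) b) (lang (k b)))"
proof -
  let ?h = "fold_tree CoBot (\<lambda>_. CoLeaf []) (\<lambda>g. CoNode (\<lambda>b. map_cotree ((#) b) (g b)))"
  show "lang (CoNode k) = CoNode (\<lambda>b. map_cotree ((#) b) (lang (k b)))"
    unfolding lang_def
  proof (rule co_eqI_Suc[OF mono_lang_fold], simp add: comp_def)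
    show "is_supremum (CoNode (\<lambda>b. map_cotree ((#) b) (co ?h (k b))))
      (\<lambda>i. CoNode (\<lambda>b. map_cotree ((#) b) (?h (idl (k b) i))))"
      by (intro is_supremum_CoNode is_supremum_map_cotree is_supremum_co mono_lang_fold
          directed_seq_mono mono_comp_idl)
  qed
qed (simp_all add: lang_def co_CoBot co_CoLeaf mono_lang_fold)

text \<open>Mapping changes labels but not shape, so it commutes with truncation and is absorbed
  into the leaf function.\<close>

lemma fold_tree_idl_map_cotree:
  "fold_tree z f g (idl (map_cotree h t) i) = fold_tree z (\<lambda>x. f (h x)) g (idl t i)"
  by (induction i arbitrary: t) (auto simp: comp_def split: cotree.split)

lemma fold_tree_sum_divide:
  fixes f :: "'a \<Rightarrow> ennreal"
  shows "fold_tree 0 (\<lambda>x. f x / c) (\<lambda>g. g True + g False) t =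
    fold_tree 0 f (\<lambda>g. g True + g False) t / c"
  by (induction t) (auto simp: add_divide_distrib_ennreal)

lemma length_weight_Cons:
  "(1 / 2 ^ length (b # l) :: ennreal) = 1 / 2 ^ length l / 2"
proof -
  \<comment> \<open>On \<open>ennreal\<close>, \<open>inverse\<close> is multiplicative except on a
    product of 0 and infinity; here both factors are finite.\<close>
  have "inverse (2 * 2 ^ n :: ennreal) = inverse 2 * inverse (2 ^ n)" for n
    by (rule ennreal_inverse_mult) (auto simp: less_top[symmetric] power_eq_top_ennreal)
  then show ?thesis
    by (simp add: divide_ennreal_def mult.commute)
qed

lemma fold_tree_idl_lang_filter:
  "fold_tree 0 (\<lambda>l. 1 / 2 ^ length l) (\<lambda>g. g True + g False) (idl (lang (cotree_filter Q t)) i) =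
    fold_tree 0 (iverson Q) (\<lambda>k. (k True + k False) / 2) (idl t i)"
proof (induction i arbitrary: t)
  case (Suc i)
  show ?case
  proof (cases t)
    case (CoNode k)
    then show ?thesis
      by (simp only: cotree_filter_simps lang_simps idl.simps cotree.case fold_tree.simps comp_def
          fold_tree_idl_map_cotree length_weight_Cons fold_tree_sum_divide Suc.IH
          add_divide_distrib_ennreal)
  \<comment> \<open>A kept leaf becomes the empty word, of weight 1; a rejected one becomes
    \<open>CoBot\<close>, of weight 0.\<close>
  qed (auto simp: iverson_def)
qed simp

theorem mainTheorem2:
  fixes Q :: "'a \<Rightarrow> bool" and t :: "'a cotree"
  shows "wp (iverson Q) t = mu (preimage Q t)"
  \<comment> \<open>Both sides are \<open>seq_sup\<close> of sequences that agree term by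
    term.\<close>
  by (simp add: wp_def mu_def preimage_def co_def fold_tree_idl_lang_filter)

end
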